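(* For $j\in\{0,1,\ldots,15\}$, the groupoid $2_j$ on $\{0,1\}$ is completely dissociative if and only if $j\in\{2,4,8,11,13,14\}$.
   Context: For $j\in\{0,1,\ldots,15\}$, $2_j$ denotes the groupoid on $\{0,1\}$ whose operation $\diamond$ is determined by the 4-digit binary numeral of $j$ (padded on the left with zeros): the digits, from left to right, are $0\diamond0$, $0\diamond1$, $1\diamond0$, $1\diamond1$; that is, $j=8(0\diamond 0)+4(0\diamond 1)+2(1\diamond 0)+(1\diamond 1)$. A groupoid $\langle G;\diamond\rangle$ is a set $G$ with a binary operation $\diamond$ on $G$. $\mathbf{N}=\{1,2,3,\ldots\}$, and $G^\omega$ is the set of infinite sequences $\vec g=g_0g_1g_2\ldots$ of elements of $G$. For $k\in\mathbf{N}$, $F^\sigma(k)$ is the set of formal $k$-products: the finite words $\mathbf{u}$ over the alphabet $\{\bullet,x_0,x_1,x_2,\ldots\}$ such that (1) $x_0x_1\ldots x_{k-1}$ is a subsequence of $\mathbf{u}$; (2) $\mathbf{u}$ has length $2k-1$; (3) $\bullet$ occurs exactly $k-1$ times in $\mathbf{u}$; (4) in every nonempty prefix of $\mathbf{u}$ the number of occurrences of $\bullet$ is strictly less than the number of other letters. These are exactly the reverse Polish forms of the full parenthesizations of $x_0x_1\ldots x_{k-1}$ (each variable once, in this order). For $\mathbf{u}\in F^\sigma(k)$ and $\vec g\in G^\omega$, $\vec g\,\mathbf{u}^\diamond\in G$ is the element obtained by replacing each $x_i$ in $\mathbf{u}$ by $g_i$ and each $\bullet$ by $\diamond$ and evaluating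 in reverse Polish notation ($ab\diamond$ means $a\diamond b$). $\langle G;\diamond\rangle$ is $k$-dissociative iff for every pair $\mathbf{u}\neq\mathbf{v}$ in $F^\sigma(k)$ there is $\vec g\in G^\omega$ with $\vec g\,\mathbf{u}^\diamond\neq\vec g\,\mathbf{v}^\diamond$. It is completely dissociative iff it is $k$-dissociative for every $k\ge 3$. *)

theory Defs
  imports "HOL-Library.Sublist"
begin

datatype letter = Bullet | X nat

type_synonym word = "letter list"

definition bullets :: "word \<Rightarrow> nat" where
  "bullets u = length (filter (\<lambda>a. a = Bullet) u)"

definition variables :: "word \<Rightarrow> nat" where
  "variables u = length (filter (\<lambda>a. a \<noteq> Bullet) u)"

text \<open>Here \<open>subseq\<close> is the not necessarily contiguous subsequence relation.
  The definition is meant for \<open>k \<ge> 1\<close>.\<close>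

definition formal_products :: "nat \<Rightarrow> word set" where
  "formal_products k = {u.
     subseq (map X [0..<k]) u \<and>
     length u = 2 * k - 1 \<and>
     bullets u = k - 1 \<and>
     (\<forall>p. prefix p u \<and> p \<noteq> [] \<longrightarrow> bullets p < variables p)}"

text \<open>Reverse Polish evaluation with a stack whose top is the head of the list.
  The last equation is an arbitrary value for stack underflow; by \<open>rpn_stack_singleton\<close>
  below it is never reached on a formal product, and the final stack has exactly one entry.\<close>

fun rpn_step :: "('a \<Rightarrow> 'a \<Rightarrow> 'a) \<Rightarrow> (nat \<Rightarrow> 'a) \<Rightarrow> letter \<Rightarrow> 'a list \<Rightarrow> 'a list" where
  "rpn_step f g (X i) st = g i # st"
| "rpn_step f g Bullet (b # a # st) = f a b # st"
| "rpn_step f g Bullet _ = []"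

definition rpn_eval :: "('a \<Rightarrow> 'a \<Rightarrow> 'a) \<Rightarrow> (nat \<Rightarrow> 'a) \<Rightarrow> word \<Rightarrow> 'a" where
  "rpn_eval f g u = hd (fold (rpn_step f g) u [])"

definition groupoid :: "'a set \<Rightarrow> ('a \<Rightarrow> 'a \<Rightarrow> 'a) \<Rightarrow> bool" where
  "groupoid G f \<longleftrightarrow> (\<forall>a\<in>G. \<forall>b\<in>G. f a b \<in> G)"

definition dissociative :: "nat \<Rightarrow> 'a set \<Rightarrow> ('a \<Rightarrow> 'a \<Rightarrow> 'a) \<Rightarrow> bool" where
  "dissociative k G f \<longleftrightarrow>
     (\<forall>u\<in>formal_products k. \<forall>v\<in>formal_products k. u \<noteq> v \<longrightarrow>
        (\<exists>g. (\<forall>i. g i \<in> G) \<and> rpn_eval f g u \<noteq> rpn_eval f g v))"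

definition completely_dissociative :: "'a set \<Rightarrow> ('a \<Rightarrow> 'a \<Rightarrow> 'a) \<Rightarrow> bool" where
  "completely_dissociative G f \<longleftrightarrow> (\<forall>k\<ge>3. dissociative k G f)"

text \<open>The operation of the two-element groupoid with index \<open>j\<close>: for \<open>a, b \<in> {0, 1}\<close>, the value
  at \<open>(a, b)\<close> is the binary digit of \<open>j\<close> of weight \<open>2 ^ (3 - (2 * a + b))\<close>.\<close>

definition two_op :: "nat \<Rightarrow> nat \<Rightarrow> nat \<Rightarrow> nat" where
  "two_op j a b = (j div 2 ^ (3 - (2 * a + b))) mod 2"

lemma groupoid_two_op: "groupoid {0, 1} (two_op j)"
  by (auto simp: groupoid_def two_op_def)

lemma two_op_digits:
  assumes "j \<le> 15"
  shows "j = 8 * two_op j 0 0 + 4 * two_op j 0 1 + 2 * two_op j 1 0 + two_op j 1 1"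
proof -
  have "j \<in> set [0..<16]"
    using assms by simp
  then show ?thesis
    by (auto simp: two_op_def upt_rec)
qed

lemma rpn_stack:
  assumes "groupoid G f" and "\<forall>i. g i \<in> G"
    and "\<forall>p. prefix p u \<and> p \<noteq> [] \<longrightarrow> bullets p < variables p"
  shows "length (fold (rpn_step f g) u []) + bullets u = variables u
    \<and> set (fold (rpn_step f g) u []) \<subseteq> G"
  using assms(3)
proof (induction u rule: rev_induct)
  case Nil
  then show ?case by (simp add: bullets_def variables_def)
next
  case (snoc x u)
  let ?s = "fold (rpn_step f g) u []"
  have ih: "length ?s + bullets u = variables u" "set ?s \<subseteq> G"
    using snoc by auto
  show ?case
  proof (cases x)
    case (X i)
    then show ?thesis
      using ih assms(2) by (simp add: bullets_def variables_def)
  next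
    case Bullet
    have "bullets (u @ [x]) < variables (u @ [x])"
      using snoc.prems by blast
    then have "2 \<le> length ?s"
      using ih Bullet by (simp add: bullets_def variables_def)
    then obtain b a st where st: "?s = b # a # st"
      by (metis One_nat_def Suc_1 Suc_le_length_iff)
    then have "a \<in> G" "b \<in> G" "set st \<subseteq> G"
      using ih(2) by auto
    then show ?thesis
      using ih(1) st Bullet assms(1) by (simp add: bullets_def variables_def groupoid_def)
  qed
qed

lemma rpn_stack_singleton:
  assumes "groupoid G f" and "\<forall>i. g i \<in> G" and "u \<in> formal_products k" and "k \<ge> 1"
  shows "fold (rpn_step f g) u [] = [rpn_eval f g u] \<and> rpn_eval f g u \<in> G"
proof -
  have "bullets u + variables u = length u"
    by (simp add: bullets_def variables_def sum_length_filter_compl)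
  moreover have "length u = 2 * k - 1" "bullets u = k - 1"
    using assms(3) by (auto simp: formal_products_def)
  moreover have *: "length (fold (rpn_step f g) u []) + bullets u = variables u"
      "set (fold (rpn_step f g) u []) \<subseteq> G"
    using rpn_stack[OF assms(1,2), of u] assms(3) by (auto simp: formal_products_def)
  ultimately have "length (fold (rpn_step f g) u []) = 1"
    using assms(4) by linarith
  then obtain y where "fold (rpn_step f g) u [] = [y]"
    by (metis One_nat_def length_0_conv length_Suc_conv)
  then show ?thesis
    using *(2) by (simp add: rpn_eval_def)
qed

end

theory Submission
  imports Defs
begin

text \<open>
  Formal \<open>k\<close>-products are read as binary trees whose leaves, from left to right, are
  \<open>0, \<dots>, k - 1\<close> (\<open>formal_product_postfix\<close>), so complete dissociativity says that two different trees
  with the same leaves never induce the same function.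

  The six operations on the right-hand side are, up to renaming the two values and swapping the
  arguments, only two: implication and NAND. For both, two different trees \<open>t1 \<diamond> t2\<close> and \<open>s1 \<diamond> s2\<close>
  are separated by induction (\<open>separatesI\<close>).
  If they split the leaves at the same place, then, say, \<open>t1\<close> and \<open>s1\<close> are separated by some
  assignment of their leaves, and it suffices to give \<open>t2\<close> and \<open>s2\<close> a common value \<open>c\<close> for which
  \<open>\<lambda>a. a \<diamond> c\<close> is injective. For implication such common values come from assignments that
  do not depend on the shape of the tree: with one leaf false, the tree is false exactly when that
  leaf is the last one (\<open>eval_imp_single_false\<close>). For NAND two trees with the same leaves are made
  true simultaneously by making a left factor of one and a right factor of the other false; these
  can be chosen with disjoint leaves (\<open>nand_common_true\<close>).

  If \<open>t1\<close> has fewer leaves than \<open>s1\<close>, the two trees are separated directly. For implication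
  one makes exactly the last leaf of \<open>t1\<close> and the last leaf of all false; then \<open>t1\<close> is false and
  \<open>t1 \<longrightarrow> t2\<close> true, but \<open>s1\<close> is true and \<open>s2\<close> is false. For NAND the argument is in
  \<open>nand_different_split\<close>.

  Each of the other ten operations satisfies \<open>((ab)c)d = (a(bc))d\<close> or \<open>a((bc)d) = a(b(cd))\<close>:
  eight are associative, and the other two are the negation of the right and of the left argument.
\<close>

section \<open>Formal products as trees\<close>

datatype tree = Var nat | Prod tree tree

primrec leaves :: "tree \<Rightarrow> nat list" where
  "leaves (Var i) = [i]"
| "leaves (Prod s t) = leaves s @ leaves t"

primrec eval_tree :: "('a \<Rightarrow> 'a \<Rightarrow> 'a) \<Rightarrow> (nat \<Rightarrow> 'a) \<Rightarrow> tree \<Rightarrow> 'a" where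
  "eval_tree f g (Var i) = g i"
| "eval_tree f g (Prod s t) = f (eval_tree f g s) (eval_tree f g t)"

primrec postfix :: "tree \<Rightarrow> word" where
  "postfix (Var i) = [X i]"
| "postfix (Prod s t) = postfix s @ postfix t @ [Bullet]"

lemma leaves_nonempty [simp]: "leaves t \<noteq> []"
  by (induction t) auto

lemma leaves_singleton: "leaves t = [i] \<longleftrightarrow> t = Var i"
  by (cases t) (auto simp: append_eq_Cons_conv)

lemma fold_rpn_step_postfix: "fold (rpn_step f g) (postfix t) st = eval_tree f g t # st"
  by (induction t arbitrary: st) auto

lemma rpn_eval_postfix: "rpn_eval f g (postfix t) = eval_tree f g t"
  by (simp add: rpn_eval_def fold_rpn_step_postfix)

lemma letters_postfix: "filter (\<lambda>a. a \<noteq> Bullet) (postfix t) = map X (leaves t)"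
  by (induction t) auto

text \<open>The trees \<open>ts\<close> are the stack that reverse Polish parsing of \<open>u\<close> leaves behind, bottom
  first. The prefix condition guarantees two trees on the stack whenever a bullet is read.\<close>

lemma parse_stack:
  assumes "\<forall>p. prefix p u \<and> p \<noteq> [] \<longrightarrow> bullets p < variables p"
  shows "\<exists>ts. u = concat (map postfix ts) \<and> length ts + bullets u = variables u"
  using assms
proof (induction u rule: rev_induct)
  case Nil
  then show ?case by (simp add: bullets_def variables_def)
next
  case (snoc x u)
  obtain ts where ts: "u = concat (map postfix ts)" "length ts + bullets u = variables u"
    using snoc by auto
  show ?case
  proof (cases x)
    case (X i)
    then show ?thesis
      using ts by (intro exI[of _ "ts @ [Var i]"]) (simp add: bullets_def variables_def)
  next
    case Bullet
    have "bullets (u @ [x]) < variables (u @ [x])"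
      using snoc.prems by blast
    then have "2 \<le> length ts"
      using ts Bullet by (simp add: bullets_def variables_def)
    then obtain b a st where "rev ts = b # a # st"
      by (metis One_nat_def Suc_1 Suc_le_length_iff length_rev)
    then have "ts = rev st @ [a, b]"
      by (simp add: rev_eq_Cons_iff)
    then show ?thesis
      using ts Bullet
      by (intro exI[of _ "rev st @ [Prod a b]"]) (simp add: bullets_def variables_def)
  qed
qed

lemma formal_product_postfix:
  assumes "u \<in> formal_products k" and "k \<ge> 1"
  obtains t where "u = postfix t" and "leaves t = [0..<k]"
proof -
  have u: "subseq (map X [0..<k]) u" "length u = 2 * k - 1" "bullets u = k - 1"
    using assms(1) by (auto simp: formal_products_def)
  have "bullets u + variables u = length u"
    by (simp add: bullets_def variables_def sum_length_filter_compl)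
  then have k: "variables u = k"
    using u assms(2) by linarith
  obtain ts where ts: "u = concat (map postfix ts)" "length ts + bullets u = variables u"
    using parse_stack[of u] assms(1) by (auto simp: formal_products_def)
  then have "length ts = 1"
    using k u assms(2) by linarith
  then obtain t where t: "u = postfix t"
    using ts(1) by (auto simp: length_Suc_conv)
  \<comment> \<open>\<open>u\<close> has only \<open>k\<close> variables, so the subsequence \<open>x\<^sub>0 \<dots> x\<^sub>k\<^sub>-\<^sub>1\<close> contains them all\<close>
  have "subseq (filter (\<lambda>a. a \<noteq> Bullet) (map X [0..<k])) (filter (\<lambda>a. a \<noteq> Bullet) u)"
    using u(1) by (rule subseq_filter)
  then have "subseq (map X [0..<k]) (filter (\<lambda>a. a \<noteq> Bullet) u)"
    by (simp add: filter_map o_def)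
  then have "map X [0..<k] = filter (\<lambda>a. a \<noteq> Bullet) u"
    using k by (intro subseq_same_length) (auto simp: variables_def)
  then have "map X (leaves t) = map X [0..<k]"
    using t by (simp add: letters_postfix)
  then have "leaves t = [0..<k]"
    by (rule map_injective) (simp add: inj_def)
  with t show ?thesis
    using that by blast
qed

section \<open>Separating trees with the same leaves\<close>

definition separates :: "('a \<Rightarrow> 'a \<Rightarrow> 'a) \<Rightarrow> bool" where
  "separates f \<longleftrightarrow> (\<forall>t s. leaves t = leaves s \<and> distinct (leaves t) \<and> t \<noteq> s \<longrightarrow>
     (\<exists>g. eval_tree f g t \<noteq> eval_tree f g s))"

lemma eval_tree_cong:
  assumes "\<And>i. i \<in> set (leaves t) \<Longrightarrow> g i = h i"
  shows "eval_tree f g t = eval_tree f h t"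
  using assms by (induction t) auto

lemma eval_tree_override_in:
  assumes "set (leaves t) \<subseteq> A"
  shows "eval_tree f (override_on h g A) t = eval_tree f g t"
  using assms by (intro eval_tree_cong) auto

lemma eval_tree_override_out:
  assumes "set (leaves t) \<inter> A = {}"
  shows "eval_tree f (override_on h g A) t = eval_tree f h t"
  using assms by (intro eval_tree_cong) (auto simp: override_on_def)

text \<open>Two trees are compared at the root. The premises \<open>common_right\<close> and \<open>common_left\<close> serve
  trees that split their leaves at the same place: they let a difference between two left or two
  right factors reach the root. The last premise is the case of different splits, \<open>bs\<close> being
  the leaves on which the two sides disagree about the factor they belong to.\<close>

lemma separatesI:
  assumes common_right: "\<And>t s. leaves t = leaves s \<Longrightarrow> distinct (leaves t) \<Longrightarrow>
      \<exists>g. eval_tree f g t = eval_tree f g s \<and> inj (\<lambda>a. f a (eval_tree f g s))"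
    and common_left: "\<And>t s. leaves t = leaves s \<Longrightarrow> distinct (leaves t) \<Longrightarrow>
      \<exists>g. eval_tree f g t = eval_tree f g s \<and> inj (f (eval_tree f g s))"
    and different_split: "\<And>t1 t2 s1 s2 bs. leaves s1 = leaves t1 @ bs \<Longrightarrow>
      leaves t2 = bs @ leaves s2 \<Longrightarrow> bs \<noteq> [] \<Longrightarrow> distinct (leaves (Prod t1 t2)) \<Longrightarrow>
      \<exists>g. eval_tree f g (Prod t1 t2) \<noteq> eval_tree f g (Prod s1 s2)"
  shows "separates f"
proof -
  have "\<exists>g. eval_tree f g t \<noteq> eval_tree f g s"
    if "leaves t = leaves s" "distinct (leaves t)" "t \<noteq> s" for t s
    using that
  proof (induction t arbitrary: s)
    case (Var i)
    then show ?case
      by (metis leaves.simps(1) leaves_singleton)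
  next
    case (Prod t1 t2)
    obtain s1 s2 where s: "s = Prod s1 s2"
      using Prod.prems by (cases s) (auto simp: append_eq_Cons_conv)
    have app: "leaves t1 @ leaves t2 = leaves s1 @ leaves s2"
      using Prod.prems s by simp
    then consider (same) "leaves t1 = leaves s1" "leaves t2 = leaves s2"
      | (shorter) bs where "leaves s1 = leaves t1 @ bs" "leaves t2 = bs @ leaves s2" "bs \<noteq> []"
      | (longer) bs where "leaves t1 = leaves s1 @ bs" "leaves s2 = bs @ leaves t2" "bs \<noteq> []"
      unfolding append_eq_append_conv2 by (metis append_Nil append_Nil2)
    then show ?case
    proof cases
      case same
      have dist: "distinct (leaves t1)" "distinct (leaves t2)"
        "set (leaves t1) \<inter> set (leaves t2) = {}"
        using Prod.prems(2) by auto
      show ?thesis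
      proof (cases "t1 = s1")
        case False
        then obtain g where g: "eval_tree f g t1 \<noteq> eval_tree f g s1"
          using Prod.IH(1) same dist by blast
        obtain h where h: "eval_tree f h t2 = eval_tree f h s2"
          "inj (\<lambda>a. f a (eval_tree f h s2))"
          using common_right same dist by blast
        let ?g = "override_on h g (set (leaves t1))"
        have "eval_tree f ?g t1 = eval_tree f g t1" "eval_tree f ?g s1 = eval_tree f g s1"
          "eval_tree f ?g t2 = eval_tree f h t2" "eval_tree f ?g s2 = eval_tree f h s2"
          using same dist
          by (auto intro!: eval_tree_override_in eval_tree_override_out)
        then show ?thesis
          using g h s by (intro exI[of _ ?g]) (auto dest: injD)
      next
        case True
        then obtain g where g: "eval_tree f g t2 \<noteq> eval_tree f g s2"
          using Prod.IH(2) Prod.prems(3) same dist s by blast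
        obtain h where h: "eval_tree f h t1 = eval_tree f h s1" "inj (f (eval_tree f h s1))"
          using common_left same dist by blast
        let ?g = "override_on g h (set (leaves t1))"
        have "eval_tree f ?g t1 = eval_tree f h t1" "eval_tree f ?g s1 = eval_tree f h s1"
          "eval_tree f ?g t2 = eval_tree f g t2" "eval_tree f ?g s2 = eval_tree f g s2"
          using same dist
          by (auto intro!: eval_tree_override_in eval_tree_override_out)
        then show ?thesis
          using g h s by (intro exI[of _ ?g]) (auto dest: injD)
      qed
    next
      case shorter
      then show ?thesis
        using different_split[of s1 t1 bs t2 s2] Prod.prems(2) s by blast
    next
      case longer
      then show ?thesis
        using different_split[of t1 s1 bs s2 t2] Prod.prems(1,2) s by metis
    qed
  qed
  then show ?thesis
    by (auto simp: separates_def)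
qed

section \<open>Implication\<close>

text \<open>A single false leaf inside \<open>t1\<close> leaves \<open>t2\<close>, and hence \<open>t1 \<longrightarrow> t2\<close>, true. So the false
  leaf falsifies the tree only if it is the last one at every step down the right spine.\<close>

lemma eval_imp_single_false:
  assumes "distinct (leaves t)"
  shows "eval_tree (\<longrightarrow>) (\<lambda>i. i \<noteq> x) t \<longleftrightarrow> x \<noteq> last (leaves t)"
  using assms
proof (induction t)
  case (Prod t1 t2)
  have "set (leaves t1) \<inter> set (leaves t2) = {}"
    using Prod.prems by simp
  then have "last (leaves t1) \<noteq> last (leaves t2)"
    by (metis disjoint_iff last_in_set leaves_nonempty)
  then show ?case
    using Prod by auto
qed auto

lemma eval_imp_all_true: "eval_tree (\<longrightarrow>) (\<lambda>i. True) t"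
  by (induction t) auto

lemma separates_imp: "separates (\<longrightarrow>)"
proof (rule separatesI)
  fix t s assume ts: "leaves t = leaves s" "distinct (leaves t)"
  show "\<exists>g. eval_tree (\<longrightarrow>) g t = eval_tree (\<longrightarrow>) g s \<and> inj (\<lambda>a. a \<longrightarrow> eval_tree (\<longrightarrow>) g s)"
    using ts eval_imp_single_false[of t "last (leaves t)"]
      eval_imp_single_false[of s "last (leaves t)"]
    by (intro exI[of _ "\<lambda>i. i \<noteq> last (leaves t)"]) (simp add: inj_def)
  show "\<exists>g. eval_tree (\<longrightarrow>) g t = eval_tree (\<longrightarrow>) g s \<and> inj ((\<longrightarrow>) (eval_tree (\<longrightarrow>) g s))"
    using eval_imp_all_true by (intro exI[of _ "\<lambda>i. True"]) (simp add: inj_def)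
next
  fix t1 t2 s1 s2 bs
  assume split: "leaves s1 = leaves t1 @ bs" "leaves t2 = bs @ leaves s2" "bs \<noteq> []"
    and dist: "distinct (leaves (Prod t1 t2))"
  define x where "x = last (leaves t1)"
  define y where "y = last (leaves s2)"
  let ?g = "\<lambda>i. i \<noteq> x \<and> i \<noteq> y"
  have x: "x \<in> set (leaves t1)" and y: "y \<in> set (leaves s2)"
    by (simp_all add: x_def y_def)
  have "last bs \<in> set bs"
    using split(3) by simp
  then have x_not_last: "x \<noteq> last (leaves s1)"
    using x split dist by auto
  have "eval_tree (\<longrightarrow>) ?g t1 = eval_tree (\<longrightarrow>) (\<lambda>i. i \<noteq> x) t1"
    using y split dist by (intro eval_tree_cong) auto
  then have "\<not> eval_tree (\<longrightarrow>) ?g t1"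
    using eval_imp_single_false[of t1 x] dist by (simp add: x_def)
  moreover have "eval_tree (\<longrightarrow>) ?g s1 = eval_tree (\<longrightarrow>) (\<lambda>i. i \<noteq> x) s1"
    using y split dist by (intro eval_tree_cong) auto
  then have "eval_tree (\<longrightarrow>) ?g s1"
    using eval_imp_single_false[of s1 x] split dist x_not_last by auto
  moreover have "eval_tree (\<longrightarrow>) ?g s2 = eval_tree (\<longrightarrow>) (\<lambda>i. i \<noteq> y) s2"
    using x split dist by (intro eval_tree_cong) auto
  then have "\<not> eval_tree (\<longrightarrow>) ?g s2"
    using eval_imp_single_false[of s2 y] split dist by (simp add: y_def)
  ultimately show "\<exists>g. eval_tree (\<longrightarrow>) g (Prod t1 t2) \<noteq> eval_tree (\<longrightarrow>) g (Prod s1 s2)"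
    by (intro exI[of _ ?g]) simp
qed

section \<open>NAND\<close>

definition nand :: "bool \<Rightarrow> bool \<Rightarrow> bool" where
  "nand a b \<longleftrightarrow> \<not> (a \<and> b)"

lemma eval_nand_Prod:
  "eval_tree nand g (Prod s t) \<longleftrightarrow> \<not> (eval_tree nand g s \<and> eval_tree nand g t)"
  by (simp add: nand_def)

lemma nand_onto:
  assumes "distinct (leaves t)"
  obtains g where "eval_tree nand g t = c"
proof -
  have "\<exists>g. eval_tree nand g t = c"
    using assms
  proof (induction t arbitrary: c)
    case (Var i)
    show ?case
      by (intro exI[of _ "\<lambda>_. c"]) simp
  next
    case (Prod t1 t2)
    obtain g where g: "eval_tree nand g t1 = (\<not> c)"
      using Prod.IH(1)[of "\<not> c"] Prod.prems by auto
    obtain h where h: "eval_tree nand h t2"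
      using Prod.IH(2)[of True] Prod.prems by auto
    let ?g = "override_on h g (set (leaves t1))"
    have "eval_tree nand ?g t1 = eval_tree nand g t1" "eval_tree nand ?g t2 = eval_tree nand h t2"
      using Prod.prems by (auto intro!: eval_tree_override_in eval_tree_override_out)
    then show ?case
      using g h
        by (intro exI[of _ ?g]) (simp add: eval_nand_Prod del: eval_tree.simps)
  qed
  then show ?thesis
    using that by blast
qed

lemma nand_onto_disjoint:
  assumes "distinct (leaves t @ leaves s)"
  obtains g where "eval_tree nand g t = c" "eval_tree nand g s = d"
proof -
  obtain g where g: "eval_tree nand g t = c"
    using nand_onto[of t c] assms by (metis distinct_append)
  obtain h where h: "eval_tree nand h s = d"
    using nand_onto[of s d] assms by (metis distinct_append)
  have "eval_tree nand (override_on h g (set (leaves t))) t = c"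
    "eval_tree nand (override_on h g (set (leaves t))) s = d"
    using g h assms by (auto simp: eval_tree_override_in eval_tree_override_out Int_commute)
  then show ?thesis
    using that by blast
qed

text \<open>At a root, one false factor suffices. The left factor of the tree with the earlier split and
  the right factor of the other have disjoint leaves, so both can be made false at once, however
  different the two trees are.\<close>

lemma nand_common_true:
  assumes "leaves t = leaves s" and "distinct (leaves t)"
  shows "\<exists>g. eval_tree nand g t \<and> eval_tree nand g s"
proof (cases t)
  case (Var i)
  then have "s = t"
    using assms leaves_singleton[of s i] by simp
  then show ?thesis
    using nand_onto[of t True] assms(2) by auto
next
  case t: (Prod t1 t2)
  obtain s1 s2 where s: "s = Prod s1 s2"
    using assms t by (cases s) (auto simp: append_eq_Cons_conv)
  have dist: "distinct (leaves t1 @ leaves t2)" "distinct (leaves s1 @ leaves s2)"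
    using assms t s by auto
  have "leaves t1 @ leaves t2 = leaves s1 @ leaves s2"
    using assms t s by simp
  then consider (short) bs where "leaves s1 = leaves t1 @ bs"
    | (long) bs where "leaves t1 = leaves s1 @ bs"
    unfolding append_eq_append_conv2 by metis
  then show ?thesis
  proof cases
    case short
    then obtain g where "\<not> eval_tree nand g t1" "\<not> eval_tree nand g s2"
      using nand_onto_disjoint[of t1 s2 False False] dist by (auto simp: Int_Un_distrib)
    then show ?thesis
      by (intro exI[of _ g]) (simp add: eval_nand_Prod t s del: eval_tree.simps)
  next
    case long
    then obtain g where "\<not> eval_tree nand g s1" "\<not> eval_tree nand g t2"
      using nand_onto_disjoint[of s1 t2 False False] dist by (auto simp: Int_Un_distrib)
    then show ?thesis
      by (intro exI[of _ g]) (simp add: eval_nand_Prod t s del: eval_tree.simps)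
  qed
qed

text \<open>A change of the first leaf passes through every node on the left spine once the right factors
  hanging off that spine are made true.\<close>

lemma nand_depends_on_first_leaf:
  assumes "distinct (leaves t)"
  shows "\<exists>g c. eval_tree nand (g(hd (leaves t) := c)) t \<noteq> eval_tree nand g t"
  using assms
proof (induction t)
  case (Var i)
  show ?case
    by (intro exI[of _ "\<lambda>_. False"] exI[of _ True]) simp
next
  case (Prod t1 t2)
  let ?x = "hd (leaves t1)"
  obtain g c where g: "eval_tree nand (g(?x := c)) t1 \<noteq> eval_tree nand g t1"
    using Prod.IH(1) Prod.prems by (metis distinct_append leaves.simps(2))
  obtain h where h: "eval_tree nand h t2"
    using nand_onto[of t2 True] Prod.prems by auto
  let ?g = "override_on h g (set (leaves t1))"
  have x: "?x \<in> set (leaves t1)"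
    by simp
  have "?g(?x := c) = override_on h (g(?x := c)) (set (leaves t1))"
    using x by (intro ext) (auto simp: override_on_def)
  then have "eval_tree nand (?g(?x := c)) t1 = eval_tree nand (g(?x := c)) t1"
    "eval_tree nand (?g(?x := c)) t2 = eval_tree nand h t2"
    "eval_tree nand ?g t1 = eval_tree nand g t1"
    "eval_tree nand ?g t2 = eval_tree nand h t2"
    using Prod.prems by (auto intro!: eval_tree_override_in eval_tree_override_out)
  then show ?case
    using g h by (intro exI[of _ ?g] exI[of _ c])
      (simp add: eval_nand_Prod del: eval_tree.simps fun_upd_apply)
qed

text \<open>Let \<open>s1\<close> be \<open>u \<diamond> v\<close>. If \<open>u\<close> contains the leaves of \<open>t1\<close>, then \<open>t1\<close>, \<open>v\<close> and \<open>s2\<close> have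
  disjoint leaves, and making the first two false and \<open>s2\<close> true makes \<open>t1 \<diamond> t2\<close> true and
  \<open>s1 \<diamond> s2\<close> false. Otherwise the leaves of \<open>u\<close> and those of \<open>t1\<close> are both disjoint from those of
  \<open>t2\<close> and \<open>s2\<close>. As \<open>t2\<close> depends on its first leaf, which does not occur in \<open>s2\<close>, the values of
  \<open>t2\<close> and \<open>s2\<close> differ for some assignment. If \<open>s2\<close> is the true one, make \<open>u\<close> false:
  this forces \<open>s1\<close> to be true, so \<open>s1 \<diamond> s2\<close> is false and \<open>t1 \<diamond> t2\<close> is true.
  If \<open>t2\<close> is the true one, making \<open>t1\<close> true has the opposite effect.\<close>

lemma nand_different_split:
  assumes split: "leaves s1 = leaves t1 @ bs" "leaves t2 = bs @ leaves s2" "bs \<noteq> []"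
    and dist: "distinct (leaves (Prod t1 t2))"
  shows "\<exists>g. eval_tree nand g (Prod t1 t2) \<noteq> eval_tree nand g (Prod s1 s2)"
proof -
  have d: "distinct (leaves t1 @ bs @ leaves s2)"
    using split dist by auto
  obtain u v where s1: "s1 = Prod u v"
    using split by (cases s1) (auto simp: Cons_eq_append_conv)
  have "leaves u @ leaves v = leaves t1 @ bs"
    using split s1 by simp
  then consider (long) cs where "leaves u = leaves t1 @ cs" "cs @ leaves v = bs"
    | (short) cs where "leaves t1 = leaves u @ cs"
    unfolding append_eq_append_conv2 by metis
  then show ?thesis
  proof cases
    case long
    then have d': "distinct (leaves t1 @ cs @ leaves v @ leaves s2)"
      using d by auto
    obtain g where g: "\<not> eval_tree nand g t1" "\<not> eval_tree nand g v"
      using nand_onto_disjoint[of t1 v False False] d' by (auto simp: Int_Un_distrib)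
    obtain h where h: "eval_tree nand h s2"
      using nand_onto[of s2 True] d' by auto
    let ?g = "override_on g h (set (leaves s2))"
    have "eval_tree nand ?g t1 = eval_tree nand g t1" "eval_tree nand ?g v = eval_tree nand g v"
      "eval_tree nand ?g s2 = eval_tree nand h s2"
      using d' by (auto intro!: eval_tree_override_in eval_tree_override_out)
    then show ?thesis
      using g h
        by (intro exI[of _ ?g]) (simp add: eval_nand_Prod s1 del: eval_tree.simps)
  next
    case short
    have x: "hd (leaves t2) \<notin> set (leaves s2)"
      using split d by (cases bs) auto
    have "distinct (leaves t2)"
      using dist by simp
    then obtain g c where
      "eval_tree nand (g(hd (leaves t2) := c)) t2 \<noteq> eval_tree nand g t2"
      using nand_depends_on_first_leaf by blast
    moreover have "eval_tree nand (g(hd (leaves t2) := c)) s2 = eval_tree nand g s2"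
      using x by (intro eval_tree_cong) auto
    ultimately obtain h where h: "eval_tree nand h t2 \<noteq> eval_tree nand h s2"
      by metis
    have out: "eval_tree nand (override_on h k (set (leaves t1))) t2 = eval_tree nand h t2"
      "eval_tree nand (override_on h k (set (leaves t1))) s2 = eval_tree nand h s2" for k
      using d split by (auto intro!: eval_tree_override_out)
    show ?thesis
    proof (cases "eval_tree nand h t2")
      case True
      obtain k where k: "eval_tree nand k t1"
        using nand_onto[of t1 True] d by auto
      let ?g = "override_on h k (set (leaves t1))"
      have "eval_tree nand ?g t1 = eval_tree nand k t1"
        by (rule eval_tree_override_in) simp
      then show ?thesis
        using True k h out[of k]
          by (intro exI[of _ ?g]) (simp add: eval_nand_Prod del: eval_tree.simps)
    next
      case False
      obtain k where k: "\<not> eval_tree nand k u"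
        using nand_onto[of u False] d short by auto
      let ?g = "override_on h k (set (leaves t1))"
      have "eval_tree nand ?g u = eval_tree nand k u"
        using short by (intro eval_tree_override_in) simp
      then show ?thesis
        using False k h out[of k]
          by (intro exI[of _ ?g]) (simp add: eval_nand_Prod s1 del: eval_tree.simps)
    qed
  qed
qed

lemma separates_nand: "separates nand"
proof (rule separatesI)
  fix t s assume "leaves t = leaves s" "distinct (leaves t)"
  then obtain g where g: "eval_tree nand g t" "eval_tree nand g s"
    using nand_common_true by blast
  show "\<exists>g. eval_tree nand g t = eval_tree nand g s \<and> inj (\<lambda>a. nand a (eval_tree nand g s))"
    using g by (intro exI[of _ g]) (simp add: nand_def inj_def)
  show "\<exists>g. eval_tree nand g t = eval_tree nand g s \<and> inj (nand (eval_tree nand g s))"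
    using g by (intro exI[of _ g]) (simp add: nand_def inj_def)
qed (rule nand_different_split)

section \<open>Symmetries\<close>

primrec mirror :: "tree \<Rightarrow> tree" where
  "mirror (Var i) = Var i"
| "mirror (Prod s t) = Prod (mirror t) (mirror s)"

lemma mirror_mirror: "mirror (mirror t) = t"
  by (induction t) auto

lemma leaves_mirror: "leaves (mirror t) = rev (leaves t)"
  by (induction t) auto

lemma eval_tree_mirror: "eval_tree f g (mirror t) = eval_tree (\<lambda>a b. f b a) g t"
  by (induction t) auto

text \<open>Swapping the arguments of the operation amounts to mirroring the trees, which reverses the
  leaves of both and keeps different trees different.\<close>

lemma separates_swap:
  assumes "separates f"
  shows "separates (\<lambda>a b. f b a)"
  unfolding separates_def
proof (intro allI impI)
  fix t s assume ts: "leaves t = leaves s \<and> distinct (leaves t) \<and> t \<noteq> s"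
  then have "leaves (mirror t) = leaves (mirror s) \<and> distinct (leaves (mirror t))
      \<and> mirror t \<noteq> mirror s"
    by (metis distinct_rev leaves_mirror mirror_mirror)
  then show "\<exists>g. eval_tree (\<lambda>a b. f b a) g t \<noteq> eval_tree (\<lambda>a b. f b a) g s"
    using assms unfolding separates_def eval_tree_mirror[of f, symmetric] by blast
qed

text \<open>The injection \<open>\<phi>\<close> carries a separating assignment for \<open>f\<close> to one for \<open>f'\<close>. Taking it
  from the truth values to \<open>{0, 1}\<close> in both possible ways gives an operation and its dual.\<close>

lemma completely_dissociative_if_separates:
  assumes sep: "separates f" and "inj \<phi>" and G: "range \<phi> \<subseteq> G"
    and hom: "\<And>a b. f' (\<phi> a) (\<phi> b) = \<phi> (f a b)"
  shows "completely_dissociative G f'"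
  unfolding completely_dissociative_def dissociative_def
proof (intro allI impI ballI)
  fix k :: nat and u v
  assume "3 \<le> k" and uv: "u \<in> formal_products k" "v \<in> formal_products k" "u \<noteq> v"
  then obtain t s where t: "u = postfix t" "leaves t = [0..<k]"
    and s: "v = postfix s" "leaves s = [0..<k]"
    by (metis formal_product_postfix le_trans one_le_numeral)
  then obtain g where g: "eval_tree f g t \<noteq> eval_tree f g s"
    using sep uv(3) by (metis distinct_upt separates_def)
  have "eval_tree f' (\<phi> \<circ> g) r = \<phi> (eval_tree f g r)" for r
    by (induction r) (auto simp: hom)
  then have "rpn_eval f' (\<phi> \<circ> g) u \<noteq> rpn_eval f' (\<phi> \<circ> g) v"
    using g \<open>inj \<phi>\<close> by (simp add: t s rpn_eval_postfix inj_eq)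
  moreover have "\<forall>i. (\<phi> \<circ> g) i \<in> G"
    using G by auto
  ultimately show "\<exists>g. (\<forall>i. g i \<in> G) \<and> rpn_eval f' g u \<noteq> rpn_eval f' g v"
    by blast
qed

section \<open>The sixteen operations\<close>

lemma completely_dissociative_two_op:
  assumes "j \<in> {2, 4, 8, 11, 13, 14}"
  shows "completely_dissociative {0, 1} (two_op j)"
proof -
  \<comment> \<open>truth read as 1, respectively as 0\<close>
  define pos neg :: "bool \<Rightarrow> nat" where "pos a = (if a then 1 else 0)"
    and "neg a = (if a then 0 else 1)" for a
  have inj: "inj pos" "inj neg" and ran: "range pos \<subseteq> {0, 1}" "range neg \<subseteq> {0, 1}"
    by (auto simp: inj_def pos_def neg_def)
  note cd = completely_dissociative_if_separates
  note imp = separates_imp and imp' = separates_swap[OF separates_imp]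
  consider "j = 2" | "j = 4" | "j = 8" | "j = 11" | "j = 13" | "j = 14"
    using assms by blast
  then show ?thesis
  proof cases
    case 1
    show ?thesis
      by (rule cd[OF imp' inj(2) ran(2)]) (simp add: 1 two_op_def neg_def)
  next
    case 2
    show ?thesis
      by (rule cd[OF imp inj(2) ran(2)]) (simp add: 2 two_op_def neg_def)
  next
    case 3
    show ?thesis
      by (rule cd[OF separates_nand inj(2) ran(2)]) (simp add: 3 two_op_def neg_def nand_def)
  next
    case 4
    show ?thesis
      by (rule cd[OF imp' inj(1) ran(1)]) (simp add: 4 two_op_def pos_def)
  next
    case 5
    show ?thesis
      by (rule cd[OF imp inj(1) ran(1)]) (simp add: 5 two_op_def pos_def)
  next
    case 6
    show ?thesis
      by (rule cd[OF separates_nand inj(1) ran(1)]) (simp add: 6 two_op_def pos_def nand_def)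
  qed
qed

lemma formal_products_4:
  "[X 0, X 1, Bullet, X 2, Bullet, X 3, Bullet] \<in> formal_products 4"
  "[X 0, X 1, X 2, Bullet, Bullet, X 3, Bullet] \<in> formal_products 4"
  "[X 0, X 1, X 2, Bullet, X 3, Bullet, Bullet] \<in> formal_products 4"
  "[X 0, X 1, X 2, X 3, Bullet, Bullet, Bullet] \<in> formal_products 4"
  by (simp_all add: formal_products_def bullets_def variables_def upt_rec imp_conjL
      all_conj_distrib flip: in_set_prefixes)

text \<open>Products of four factors are the right length: the operations \<open>\<not> b\<close> and \<open>\<not> a\<close> still
  separate \<open>(ab)c\<close> from \<open>a(bc)\<close>, but the first satisfies the first identity below and the second
  the other one. An associative operation satisfies both.\<close>

lemma not_completely_dissociative:
  assumes "(\<forall>a\<in>G. \<forall>b\<in>G. \<forall>c\<in>G. \<forall>d\<in>G. f (f (f a b) c) d = f (f a (f b c)) d)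
    \<or> (\<forall>a\<in>G. \<forall>b\<in>G. \<forall>c\<in>G. \<forall>d\<in>G. f a (f (f b c) d) = f a (f b (f c d)))"
  shows "\<not> completely_dissociative G f"
proof
  assume "completely_dissociative G f"
  then have "dissociative 4 G f"
    by (simp add: completely_dissociative_def)
  then have sep: "u \<in> formal_products 4 \<Longrightarrow> v \<in> formal_products 4 \<Longrightarrow> u \<noteq> v \<Longrightarrow>
      \<exists>g. (\<forall>i. g i \<in> G) \<and> rpn_eval f g u \<noteq> rpn_eval f g v" for u v
    by (auto simp: dissociative_def)
  show False
    using sep[OF formal_products_4(1,2)] sep[OF formal_products_4(3,4)] assms
    by (simp add: rpn_eval_def) metis
qed

lemma two_op_values:
  "two_op j 0 0 = j div 8 mod 2" "two_op j 0 1 = j div 4 mod 2"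
  "two_op j 1 0 = j div 2 mod 2" "two_op j 1 1 = j mod 2"
  by (simp_all add: two_op_def)

theorem theorem3p7:
  fixes j :: nat
  assumes "j \<in> {0..15}"
  shows "completely_dissociative {0, 1} (two_op j) \<longleftrightarrow> j \<in> {2, 4, 8, 11, 13, 14}"
proof
  show "j \<in> {2, 4, 8, 11, 13, 14}" if "completely_dissociative {0, 1} (two_op j)"
  proof (rule ccontr)
    assume "j \<notin> {2, 4, 8, 11, 13, 14}"
    moreover have "j \<in> set [0..<16]"
      using assms by simp
    ultimately have "j \<in> {0, 1, 3, 5, 6, 7, 9, 10, 12, 15}"
      by (auto simp: upt_rec)
    then have "\<not> completely_dissociative {0, 1} (two_op j)"
      by (elim insertE emptyE; intro not_completely_dissociative)
        (simp_all add: two_op_values del: One_nat_def)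
    with that show False
      by blast
  qed
qed (rule completely_dissociative_two_op)

end
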